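(* Let $(L,[\cdot,\cdot,\cdot],\alpha,\beta)$ be a $3$-Bihom-Lie algebra over a field $\mathbb{K}$. Then there is a product structure on $L$ if and only if $L=L_+\oplus L_-$ (direct sum of vector spaces), where $L_+$ and $L_-$ are Bihom subalgebras of $L$.
   Context: A $3$-Bihom-Lie algebra over a field $\mathbb{K}$ is a $4$-tuple $(L,[\cdot,\cdot,\cdot],\alpha,\beta)$ consisting of a $\mathbb{K}$-vector space $L$, a $3$-linear map $[\cdot,\cdot,\cdot]\colon L\times L\times L\to L$ and two linear maps $\alpha,\beta\colon L\to L$ such that for all $x,y,z,u,v\in L$: (1) $\alpha\beta=\beta\alpha$; (2) $\alpha([x,y,z])=[\alpha(x),\alpha(y),\alpha(z)]$ and $\beta([x,y,z])=[\beta(x),\beta(y),\beta(z)]$; (3) $[\beta(x),\beta(y),\alpha(z)]=-[\beta(y),\beta(x),\alpha(z)]=-[\beta(x),\beta(z),\alpha(y)]$; (4) $[\beta^2(u),\beta^2(v),[\beta(x),\beta(y),\alpha(z)]]=[\beta^2(y),\beta^2(z),[\beta(u),\beta(v),\alpha(x)]]-[\beta^2(x),\beta^2(z),[\beta(u),\beta(v),\alpha(y)]]+[\beta^2(x),\beta^2(y),[\beta(u),\beta(v),\alpha(z)]]$. A linear subspace $\eta\subseteq L$ is a Bihom subalgebra if $\alpha(\eta)\subseteq\eta$, $\beta(\eta)\subseteq\eta$ and $[x,y,z]\in\eta$ for all $x,y,z\in\eta$. An almost product structure on $L$ is a linear map $E\colon L\to L$ with $E^2=\mathrm{Id}$, $E\neq\pm\mathrm{Id}$,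 $\alpha E=E\alpha$ and $\beta E=E\beta$. It is a product structure if for all $x,y,z\in L$, $$E[x,y,z]=[Ex,Ey,Ez]+[Ex,y,z]+[x,Ey,z]+[x,y,Ez]-E[Ex,Ey,z]-E[x,Ey,Ez]-E[Ex,y,Ez].$$
   Formalization: The field is assumed to have characteristic different from 2, and the Bihom subalgebras L_+ and L_- are both required to be nonzero; without these conditions the equivalence is false. *)

theory Defs
  imports Complex_Main
begin

locale bihom_lie3 = vector_space scale
  for scale :: "'k::field \<Rightarrow> 'l::ab_group_add \<Rightarrow> 'l" +
  fixes br :: "'l \<Rightarrow> 'l \<Rightarrow> 'l \<Rightarrow> 'l"
    and \<alpha> \<beta> :: "'l \<Rightarrow> 'l"
  assumes br_linear1: "Vector_Spaces.linear scale scale (\<lambda>x. br x y z)"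
    and br_linear2: "Vector_Spaces.linear scale scale (\<lambda>y. br x y z)"
    and br_linear3: "Vector_Spaces.linear scale scale (\<lambda>z. br x y z)"
    and linear_\<alpha>: "Vector_Spaces.linear scale scale \<alpha>"
    and linear_\<beta>: "Vector_Spaces.linear scale scale \<beta>"
    and \<alpha>_\<beta>: "\<alpha> \<circ> \<beta> = \<beta> \<circ> \<alpha>"
    and \<alpha>_br: "\<alpha> (br x y z) = br (\<alpha> x) (\<alpha> y) (\<alpha> z)"
    and \<beta>_br: "\<beta> (br x y z) = br (\<beta> x) (\<beta> y) (\<beta> z)"
    and skew12: "br (\<beta> x) (\<beta> y) (\<alpha> z) = - br (\<beta> y) (\<beta> x) (\<alpha> z)"
    and skew23: "br (\<beta> x) (\<beta> y) (\<alpha> z) = - br (\<beta> x) (\<beta> z) (\<alpha> y)"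
    and bihom_jacobi:
      "br (\<beta> (\<beta> u)) (\<beta> (\<beta> v)) (br (\<beta> x) (\<beta> y) (\<alpha> z)) =
         br (\<beta> (\<beta> y)) (\<beta> (\<beta> z)) (br (\<beta> u) (\<beta> v) (\<alpha> x))
       - br (\<beta> (\<beta> x)) (\<beta> (\<beta> z)) (br (\<beta> u) (\<beta> v) (\<alpha> y))
       + br (\<beta> (\<beta> x)) (\<beta> (\<beta> y)) (br (\<beta> u) (\<beta> v) (\<alpha> z))"
begin

definition bihom_subalgebra :: "'l set \<Rightarrow> bool" where
  "bihom_subalgebra \<eta> \<longleftrightarrow>
     subspace \<eta> \<and> \<alpha> ` \<eta> \<subseteq> \<eta> \<and> \<beta> ` \<eta> \<subseteq> \<eta> \<and>
     (\<forall>x\<in>\<eta>. \<forall>y\<in>\<eta>. \<forall>z\<in>\<eta>. br x y z \<in> \<eta>)"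

definition almost_product_structure :: "('l \<Rightarrow> 'l) \<Rightarrow> bool" where
  "almost_product_structure E \<longleftrightarrow>
     Vector_Spaces.linear scale scale E \<and>
     E \<circ> E = id \<and> E \<noteq> id \<and> E \<noteq> (\<lambda>x. - x) \<and>
     \<alpha> \<circ> E = E \<circ> \<alpha> \<and> \<beta> \<circ> E = E \<circ> \<beta>"

definition product_structure :: "('l \<Rightarrow> 'l) \<Rightarrow> bool" where
  "product_structure E \<longleftrightarrow>
     almost_product_structure E \<and>
     (\<forall>x y z. E (br x y z) =
        br (E x) (E y) (E z) + br (E x) y z + br x (E y) z + br x y (E z)
        - E (br (E x) (E y) z) - E (br x (E y) (E z)) - E (br (E x) y (E z)))"

definition direct_sum_decomposition :: "'l set \<Rightarrow> 'l set \<Rightarrow> bool" where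
  "direct_sum_decomposition U V \<longleftrightarrow>
     subspace U \<and> subspace V \<and> U \<inter> V = {0} \<and> {u + v | u v. u \<in> U \<and> v \<in> V} = UNIV"

end

end

theory Submission
  imports Defs
begin

text \<open>
  A product structure is the same thing as its pair of eigenspaces. If \<open>x, y, z\<close> lie in the
  \<open>\<epsilon>\<close>-eigenspace of \<open>E\<close> with \<open>\<epsilon> = \<plusminus>1\<close>, the product identity for \<open>w = [x, y, z]\<close> collapses to
  \<open>4 E w = 4 \<epsilon> w\<close>, so both eigenspaces are closed under the bracket. Conversely let \<open>E\<close> be
  \<open>id\<close> on \<open>L\<^sub>+\<close> and \<open>- id\<close> on \<open>L\<^sub>-\<close>. Both sides of the product identity are trilinear, and on
  homogeneous arguments the terms cancel when the signs are mixed, while for equal signs the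
  identity only says that \<open>E w = \<epsilon> w\<close>.
\<close>

context bihom_lie3
begin

lemmas br_add = module_hom.add[OF Vector_Spaces.linear.axioms(3)[OF br_linear1]]
  module_hom.add[OF Vector_Spaces.linear.axioms(3)[OF br_linear2]]
  module_hom.add[OF Vector_Spaces.linear.axioms(3)[OF br_linear3]]

lemmas br_minus = module_hom.neg[OF Vector_Spaces.linear.axioms(3)[OF br_linear1]]
  module_hom.neg[OF Vector_Spaces.linear.axioms(3)[OF br_linear2]]
  module_hom.neg[OF Vector_Spaces.linear.axioms(3)[OF br_linear3]]

lemmas br_diff = module_hom.diff[OF Vector_Spaces.linear.axioms(3)[OF br_linear1]]
  module_hom.diff[OF Vector_Spaces.linear.axioms(3)[OF br_linear2]]
  module_hom.diff[OF Vector_Spaces.linear.axioms(3)[OF br_linear3]]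

lemma double_eq_0_iff:
  fixes x :: 'l
  assumes "(2::'k) \<noteq> 0"
  shows "x + x = 0 \<longleftrightarrow> x = 0"
proof -
  have "x + x = scale 2 x"
    using scale_left_distrib[of 1 1 x] by simp
  then show ?thesis
    using assms by simp
qed

text \<open>The factor 4 is removed as two successive doublings of the difference
  \<open>x - y\<close>, so \<open>2 \<noteq> 0\<close> in the field suffices.\<close>

lemma quadruple_cancel:
  fixes x y :: 'l
  assumes "(2::'k) \<noteq> 0" and "(x + x) + (x + x) = (y + y) + (y + y)"
  shows "x = y"
proof -
  let ?d = "x - y"
  have "(?d + ?d) + (?d + ?d) = ((x + x) + (x + x)) - ((y + y) + (y + y))"
    by (simp add: algebra_simps)
  then have "(?d + ?d) + (?d + ?d) = 0"
    using assms(2) by simp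
  then show ?thesis
    by (simp add: double_eq_0_iff[OF assms(1)])
qed

lemma product_structureD:
  assumes "product_structure E"
  shows "Vector_Spaces.linear scale scale E" "E (E x) = x" "E \<noteq> id" "E \<noteq> (\<lambda>x. - x)"
    "E (\<alpha> x) = \<alpha> (E x)" "E (\<beta> x) = \<beta> (E x)"
    "E (br x y z) =
       br (E x) (E y) (E z) + br (E x) y z + br x (E y) z + br x y (E z)
       - E (br (E x) (E y) z) - E (br x (E y) (E z)) - E (br (E x) y (E z))"
  using assms unfolding product_structure_def almost_product_structure_def o_def id_def
  by metis+

lemma product_structureI:
  assumes "Vector_Spaces.linear scale scale E" "\<And>x. E (E x) = x"
    "E \<noteq> id" "E \<noteq> (\<lambda>x. - x)"
    "\<And>x. E (\<alpha> x) = \<alpha> (E x)" "\<And>x. E (\<beta> x) = \<beta> (E x)"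
    and prod: "\<And>x y z. E (br x y z) =
       br (E x) (E y) (E z) + br (E x) y z + br x (E y) z + br x y (E z)
       - E (br (E x) (E y) z) - E (br x (E y) (E z)) - E (br (E x) y (E z))"
  shows "product_structure E"
proof -
  have "almost_product_structure E"
    unfolding almost_product_structure_def using assms(1-6) by (simp add: fun_eq_iff)
  then show ?thesis
    unfolding product_structure_def using prod by blast
qed

lemma bihom_subalgebra_fixed:
  assumes two: "(2::'k) \<noteq> 0" and E: "product_structure E"
  shows "bihom_subalgebra {x. E x = x}"
proof -
  interpret E: Vector_Spaces.linear scale scale E by (fact product_structureD(1)[OF E])
  have "E (br x y z) = br x y z" if "E x = x" "E y = y" "E z = z" for x y z
  proof (rule quadruple_cancel[OF two])
    let ?w = "br x y z"
    have "E ?w = ?w + ?w + ?w + ?w - E ?w - E ?w - E ?w"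
      using product_structureD(7)[OF E, of x y z] unfolding that .
    then show "(E ?w + E ?w) + (E ?w + E ?w) = (?w + ?w) + (?w + ?w)"
      by (simp add: algebra_simps)
  qed
  then show ?thesis
    by (auto simp: bihom_subalgebra_def subspace_def E.add E.scale product_structureD(5,6)[OF E])
qed

text \<open>Every term of the product identity contains \<open>E\<close> an odd number of times (one
  or three), so the sign factors out of the whole identity. The conditions
  \<open>E \<noteq> id\<close> and \<open>E \<noteq> -id\<close> trade places, as do the two
  eigenspaces: closure of the (-1)-eigenspace under the bracket thus reduces to that of the fixed
  space.\<close>

lemma product_structure_uminus:
  assumes "product_structure E"
  shows "product_structure (\<lambda>x. - E x)"
proof -
  interpret E: Vector_Spaces.linear scale scale E by (fact product_structureD(1)[OF assms])
  interpret A: Vector_Spaces.linear scale scale \<alpha> by (fact linear_\<alpha>)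
  interpret B: Vector_Spaces.linear scale scale \<beta> by (fact linear_\<beta>)
  have "Vector_Spaces.linear scale scale (\<lambda>x. - E x)"
    by unfold_locales (simp_all add: E.add E.scale)
  moreover have "(\<lambda>x. - E x) \<noteq> id" "(\<lambda>x. - E x) \<noteq> (\<lambda>x. - x)"
    using product_structureD(3,4)[OF assms] by (auto simp: fun_eq_iff) (metis minus_minus)+
  moreover have "- E (br x y z) =
        br (- E x) (- E y) (- E z) + br (- E x) y z + br x (- E y) z + br x y (- E z)
        - - E (br (- E x) (- E y) z) - - E (br x (- E y) (- E z)) - - E (br (- E x) y (- E z))"
    for x y z
    by (subst product_structureD(7)[OF assms]) (simp add: br_minus)
  moreover have "- E (- E x) = x" "- E (\<alpha> x) = \<alpha> (- E x)" "- E (\<beta> x) = \<beta> (- E x)" for x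
    by (simp_all add: E.neg A.neg B.neg product_structureD(2,5,6)[OF assms])
  ultimately show ?thesis
    by (intro product_structureI)
qed

lemma product_structure_eigenspaces:
  assumes two: "(2::'k) \<noteq> 0" and E: "product_structure E"
  defines "U \<equiv> {x. E x = x}" and "V \<equiv> {x. E x = - x}"
  shows "bihom_subalgebra U" "bihom_subalgebra V" "U \<noteq> {0}" "V \<noteq> {0}"
    "direct_sum_decomposition U V"
proof -
  note inv = product_structureD(2)[OF E] and ne = product_structureD(3,4)[OF E]
  interpret E: Vector_Spaces.linear scale scale E by (fact product_structureD(1)[OF E])
  show U: "bihom_subalgebra U"
    unfolding U_def by (rule bihom_subalgebra_fixed[OF two E])
  have "V = {x. - E x = x}"
    unfolding V_def by (metis minus_minus)
  then show V: "bihom_subalgebra V"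
    using bihom_subalgebra_fixed[OF two product_structure_uminus[OF E]] by simp
  \<comment> \<open>These are twice the projections onto the eigenspaces; membership follows from
    \<open>E (E x) = x\<close>. If \<open>U\<close> or \<open>V\<close> were zero, the corresponding
    expression would vanish for all \<open>x\<close>, forcing \<open>E = -id\<close> or
    \<open>E = id\<close>.\<close>
  have plus: "x + E x \<in> U" and minus: "x - E x \<in> V" for x
    by (simp_all add: U_def V_def E.add E.diff inv)
  show "U \<noteq> {0}"
  proof
    assume "U = {0}"
    then have "E x = - x" for x
      using plus[of x] by (simp add: add_eq_0_iff)
    with ne show False by auto
  qed
  show "V \<noteq> {0}"
  proof
    assume "V = {0}"
    then have "E x = x" for x
      using minus[of x] by simp
    with ne show False by auto
  qed
  have "U \<inter> V = {0}"
    by (auto simp: U_def V_def eq_neg_iff_add_eq_0 double_eq_0_iff[OF two])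
  moreover have "\<exists>u v. x = u + v \<and> u \<in> U \<and> v \<in> V" for x
  proof (intro exI conjI)
    have "scale (1/2) (x + x) = x"
      using two scale_left_distrib[of 1 1 x, symmetric] by simp
    then show "x = scale (1/2) (x + E x) + scale (1/2) (x - E x)"
      by (simp flip: scale_right_distrib)
    show "scale (1/2) (x + E x) \<in> U" "scale (1/2) (x - E x) \<in> V"
      using U V plus minus by (auto simp: bihom_subalgebra_def intro: subspace_scale)
  qed
  ultimately show "direct_sum_decomposition U V"
    using U V by (auto simp: direct_sum_decomposition_def bihom_subalgebra_def)
qed

text \<open>The witness is the reflection that fixes \<open>U\<close> and negates \<open>V\<close>.
  A nonzero vector of \<open>V\<close> keeps it from being \<open>id\<close>, and one of
  \<open>U\<close> from being \<open>-id\<close>, since \<open>v = -v\<close> forces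
  \<open>v = 0\<close> when \<open>2 \<noteq> 0\<close>.\<close>

lemma product_structure_of_decomposition:
  assumes two: "(2::'k) \<noteq> 0"
    and U: "bihom_subalgebra U" "U \<noteq> {0}" and V: "bihom_subalgebra V" "V \<noteq> {0}"
    and UV: "direct_sum_decomposition U V"
  shows "\<exists>E. product_structure E"
proof -
  interpret A: Vector_Spaces.linear scale scale \<alpha> by (fact linear_\<alpha>)
  interpret B: Vector_Spaces.linear scale scale \<beta> by (fact linear_\<beta>)
  have sub: "subspace U" "subspace V"
    and int: "U \<inter> V = {0}" and span: "\<exists>u v. x = u + v \<and> u \<in> U \<and> v \<in> V" for x
    using UV unfolding direct_sum_decomposition_def by blast+
  have br: "x \<in> U \<Longrightarrow> y \<in> U \<Longrightarrow> z \<in> U \<Longrightarrow> br x y z \<in> U"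
      "x \<in> V \<Longrightarrow> y \<in> V \<Longrightarrow> z \<in> V \<Longrightarrow> br x y z \<in> V"
    and \<alpha>\<beta>: "x \<in> U \<Longrightarrow> \<alpha> x \<in> U" "x \<in> V \<Longrightarrow> \<alpha> x \<in> V"
      "x \<in> U \<Longrightarrow> \<beta> x \<in> U" "x \<in> V \<Longrightarrow> \<beta> x \<in> V" for x y z
    using U V by (auto simp: bihom_subalgebra_def)
  \<comment> \<open>Components are merely chosen pointwise here; nothing yet says that
    \<open>p\<close> and \<open>q\<close> are linear.\<close>
  obtain p q where pq: "p x + q x = x" "p x \<in> U" "q x \<in> V" for x
    using span by metis
  define E where "E x = p x - q x" for x
  \<comment> \<open>Any decomposition computes \<open>E\<close>, because two decompositions of a
    vector differ by an element of \<open>U \<inter> V\<close>. Linearity then follows by adding or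
    scaling the chosen components.\<close>
  have E: "E (u + v) = u - v" if "u \<in> U" "v \<in> V" for u v
  proof -
    have "u - p (u + v) = q (u + v) - v"
      using pq(1)[of "u + v"] by (simp add: algebra_simps)
    moreover have "u - p (u + v) \<in> U" "q (u + v) - v \<in> V"
      using that pq sub by (auto intro: subspace_diff)
    ultimately have "u - p (u + v) \<in> U \<inter> V" by simp
    then have "p (u + v) = u" using int by simp
    moreover from this have "q (u + v) = v"
      using pq(1)[of "u + v"] by simp
    ultimately show ?thesis by (simp add: E_def)
  qed
  have EU: "E u = u" if "u \<in> U" for u
    using E[OF that subspace_0[OF sub(2)]] by simp
  have EV: "E v = - v" if "v \<in> V" for v
    using E[OF subspace_0[OF sub(1)] that] by simp
  have "Vector_Spaces.linear scale scale E"
  proof unfold_locales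
    fix x y
    have "p x + p y \<in> U" "q x + q y \<in> V"
      using pq sub by (auto intro: subspace_add)
    moreover have "x + y = (p x + p y) + (q x + q y)"
      by (metis pq(1) add.assoc add.left_commute)
    ultimately show "E (x + y) = E x + E y"
      using E by (simp add: E_def)
  next
    fix r x
    have "scale r x = scale r (p x) + scale r (q x)"
      by (simp add: pq(1) flip: scale_right_distrib)
    moreover have "scale r (p x) \<in> U" "scale r (q x) \<in> V"
      using pq sub by (auto intro: subspace_scale)
    ultimately show "E (scale r x) = scale r (E x)"
      using E by (simp add: E_def scale_right_diff_distrib)
  qed
  then interpret E: Vector_Spaces.linear scale scale E .
  have "E (E x) = x" for x
    using pq(2,3) by (simp add: E_def[of x] E.diff EU EV pq(1))
  \<comment> \<open>Since \<alpha> and \<beta> preserve both summands, they carry the chosen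
    decomposition of \<open>x\<close> to decompositions of \<open>\<alpha> x\<close> and
    \<open>\<beta> x\<close>.\<close>
  moreover have "E (\<alpha> x) = \<alpha> (E x)" "E (\<beta> x) = \<beta> (E x)" for x
    using pq(2,3) E[of "\<alpha> (p x)" "\<alpha> (q x)"] E[of "\<beta> (p x)" "\<beta> (q x)"] \<alpha>\<beta>
    by (simp_all add: E_def[of x] A.diff B.diff pq(1) flip: A.add B.add)
  moreover have "E \<noteq> id"
  proof
    assume id: "E = id"
    obtain v where v: "v \<in> V" "v \<noteq> 0" using V sub subspace_0 by blast
    then have "v = - v" using EV[of v] id by simp
    then show False using v by (simp add: eq_neg_iff_add_eq_0 double_eq_0_iff[OF two])
  qed
  moreover have "E \<noteq> (\<lambda>x. - x)"
  proof
    assume neg: "E = (\<lambda>x. - x)"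
    obtain u where u: "u \<in> U" "u \<noteq> 0" using U sub subspace_0 by blast
    then have "u = - u" using EU[of u] neg by simp
    then show False using u by (simp add: eq_neg_iff_add_eq_0 double_eq_0_iff[OF two])
  qed
  moreover have "E (br x y z) =
        br (E x) (E y) (E z) + br (E x) y z + br x (E y) z + br x y (E z)
        - E (br (E x) (E y) z) - E (br x (E y) (E z)) - E (br (E x) y (E z))" for x y z
  proof -
    \<comment> \<open>Expand into eight brackets. For a mixed bracket \<open>w\<close> the
      right-hand side has coefficient 0 at \<open>w\<close> and 1 at \<open>E w\<close>, so its
      position relative to \<open>U\<close> and \<open>V\<close> is irrelevant. Only the two pure
      brackets use closure: there \<open>4 \<epsilon> w - 3 E w = E w\<close>.\<close>
    have "E (br (a + a') (b + b') (c + c')) =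
        br (a - a') (b - b') (c - c') + br (a - a') (b + b') (c + c')
        + br (a + a') (b - b') (c + c') + br (a + a') (b + b') (c - c')
        - E (br (a - a') (b - b') (c + c')) - E (br (a + a') (b - b') (c - c'))
        - E (br (a - a') (b + b') (c - c'))"
      if "a \<in> U" "b \<in> U" "c \<in> U" "a' \<in> V" "b' \<in> V" "c' \<in> V" for a b c a' b' c'
      using EU[OF br(1)[OF that(1-3)]] EV[OF br(2)[OF that(4-6)]]
      by (simp add: br_add br_diff E.add E.diff)
    from this[OF pq(2) pq(2) pq(2) pq(3) pq(3) pq(3), of x x y y z z] show ?thesis
      unfolding pq(1) E_def[symmetric] .
  qed
  ultimately show ?thesis
    using E.linear_axioms by (intro exI[of _ E] product_structureI)
qed

end

text \<open>Nonzero summands match the exclusion of \<open>id\<close> and \<open>-id\<close>: with a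
  zero summand allowed, \<open>L\<close> and \<open>{0}\<close> would always give a decomposition.
  In characteristic 2 the eigenspaces for 1 and -1 coincide and cannot split
  \<open>L\<close>.\<close>

theorem theorem3p3:
  fixes scale :: "'k::field \<Rightarrow> 'l::ab_group_add \<Rightarrow> 'l"
    and br :: "'l \<Rightarrow> 'l \<Rightarrow> 'l \<Rightarrow> 'l"
    and \<alpha> \<beta> :: "'l \<Rightarrow> 'l"
  assumes L: "bihom_lie3 scale br \<alpha> \<beta>"
    and char_not_2: "(2::'k) \<noteq> 0"
  shows "(\<exists>E. bihom_lie3.product_structure scale br \<alpha> \<beta> E) \<longleftrightarrow>
    (\<exists>Lp Lm. bihom_lie3.bihom_subalgebra scale br \<alpha> \<beta> Lp \<and>
             bihom_lie3.bihom_subalgebra scale br \<alpha> \<beta> Lm \<and>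
             Lp \<noteq> {0} \<and> Lm \<noteq> {0} \<and>
             bihom_lie3.direct_sum_decomposition scale Lp Lm)"
proof -
  interpret bihom_lie3 scale br \<alpha> \<beta> by (fact L)
  show ?thesis (is "_ \<longleftrightarrow> ?R")
  proof
    assume "\<exists>E. product_structure E"
    then obtain E where "product_structure E" ..
    from product_structure_eigenspaces[OF char_not_2 this] show ?R
      by (intro exI conjI)
  next
    assume ?R
    then show "\<exists>E. product_structure E"
      by (elim exE conjE) (rule product_structure_of_decomposition[OF char_not_2])
  qed
qed

end
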